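(* Let $n,m\ge1$ be integers, $X_1,\dots,X_n\in\mathbb{R}$, $a_1,\dots,a_m\in\mathbb{R}$, and let $Z$, $F_Z$, $z_{\min}$, $z_{\max}$, $T_Z$ be as defined in the context. Assume $z_{\min}<0<z_{\max}$. Let $T>T_Z$ be fixed, $\kappa:=T/T_Z$ and $I:=[\kappa z_{\min},\kappa z_{\max}]$. For each integer $N\ge1$ let $\tilde f$ (depending on $N$ and $T$) be as defined in the context and set $$\tilde F(x):=\int_{-\infty}^x\frac NT\,\tilde f(\xi)\,1_I(\xi)\,d\xi,\qquad x\in\mathbb{R}.$$ Let $A_d$ be the set of points of discontinuity of $F_Z$. Then, as $N\to\infty$, $$\tilde F(x)\to F_Z(x)\qquad\text{for all }x\in\mathbb{R}\setminus A_d .$$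
   Context: $\mathrm{i}$ denotes the imaginary unit. Let $\hat F_n(x)=n^{-1}\sum_{l=1}^n 1_{X_l\le x}$ be the empirical distribution function of the fixed real numbers $X_1,\dots,X_n$. Let $X^{[1]},\dots,X^{[m]}$ be independent random variables, each with distribution function $\hat F_n$, and set $Z:=\sum_{j=1}^m a_jX^{[j]}$. $F_Z$ is the cumulative distribution function of $Z$, $F_Z(x)=P(Z\le x)$. The random variable $Z$ takes finitely many values; $z_{\min}$ and $z_{\max}$ denote the smallest and largest value taken with positive probability, and $T_Z:=z_{\max}-z_{\min}$. Define $G(\nu):=\prod_{j=1}^m\left(\frac1n\sum_{l=1}^n\exp(-2\pi\mathrm{i}\,a_jX_l\nu)\right)$ for $\nu\in\mathbb{R}$, $\Delta\nu:=1/T$, $g_k:=G(k\,\Delta\nu)$ for $k\in\mathbb{Z}$, and $$\tilde f(x):=\frac1N\sum_{k=-N+1}^{N-1}g_k\exp(2\pi\mathrm{i}\,xk/T),\qquad x\in\mathbb{R}$$ (this function is real-valued). *)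

theory Defs
  imports "HOL-Probability.Probability"
begin

definition emp_cdf :: "nat \<Rightarrow> (nat \<Rightarrow> real) \<Rightarrow> real \<Rightarrow> real" where
  "emp_cdf n X x = 1 / real n * (\<Sum>l = 1..n. of_bool (X l \<le> x))"

definition pos_prob_values :: "'a measure \<Rightarrow> ('a \<Rightarrow> real) \<Rightarrow> real set" where
  "pos_prob_values M Z = {z. measure M {\<omega> \<in> space M. Z \<omega> = z} > 0}"

text \<open>
  The following three are meaningful only for a finite nonempty set of values of positive
  probability, which is the case for a finite sum of random variables that are each
  distributed according to an empirical distribution function.
\<close>

definition z_min :: "'a measure \<Rightarrow> ('a \<Rightarrow> real) \<Rightarrow> real" where
  "z_min M Z = Min (pos_prob_values M Z)"

definition z_max :: "'a measure \<Rightarrow> ('a \<Rightarrow> real) \<Rightarrow> real" where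
  "z_max M Z = Max (pos_prob_values M Z)"

definition z_range :: "'a measure \<Rightarrow> ('a \<Rightarrow> real) \<Rightarrow> real" where
  "z_range M Z = z_max M Z - z_min M Z"

definition G :: "nat \<Rightarrow> nat \<Rightarrow> (nat \<Rightarrow> real) \<Rightarrow> (nat \<Rightarrow> real) \<Rightarrow> real \<Rightarrow> complex" where
  "G n m X a \<nu> =
     (\<Prod>j = 1..m. 1 / of_nat n *
        (\<Sum>l = 1..n. exp (- 2 * of_real pi * \<i> * of_real (a j * X l * \<nu>))))"

definition g_coeff ::
    "nat \<Rightarrow> nat \<Rightarrow> (nat \<Rightarrow> real) \<Rightarrow> (nat \<Rightarrow> real) \<Rightarrow> real \<Rightarrow> int \<Rightarrow> complex" where
  "g_coeff n m X a T k = G n m X a (of_int k * (1 / T))"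

text \<open>
  The trigonometric polynomial is kept complex-valued, as its formula reads; its values are
  real by lemma \<open>f_tilde_real\<close> below.
\<close>

definition f_tilde ::
    "nat \<Rightarrow> nat \<Rightarrow> (nat \<Rightarrow> real) \<Rightarrow> (nat \<Rightarrow> real) \<Rightarrow> real \<Rightarrow> nat \<Rightarrow> real \<Rightarrow> complex" where
  "f_tilde n m X a T N x =
     1 / of_nat N * (\<Sum>k = - int N + 1..int N - 1.
        g_coeff n m X a T k * exp (2 * of_real pi * \<i> * of_real (x * of_int k / T)))"

definition F_tilde ::
    "nat \<Rightarrow> nat \<Rightarrow> (nat \<Rightarrow> real) \<Rightarrow> (nat \<Rightarrow> real) \<Rightarrow> real \<Rightarrow> real set \<Rightarrow> nat \<Rightarrow> real \<Rightarrow> complex" where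
  "F_tilde n m X a T I N x =
     (LINT \<xi>:{..x}|lborel. of_real (real N / T) * f_tilde n m X a T N \<xi> * indicator I \<xi>)"

lemma cnj_g_coeff: "cnj (g_coeff n m X a T k) = g_coeff n m X a T (- k)"
  by (simp add: g_coeff_def G_def exp_cnj)

lemma f_tilde_real: "f_tilde n m X a T N x \<in> \<real>"
proof -
  let ?h = "\<lambda>k. g_coeff n m X a T k * exp (2 * of_real pi * \<i> * of_real (x * of_int k / T))"
  have "cnj (\<Sum>k = - int N + 1..int N - 1. ?h k) = (\<Sum>k = - int N + 1..int N - 1. ?h (- k))"
    by (simp add: cnj_g_coeff exp_cnj)
  also have "\<dots> = (\<Sum>k = - int N + 1..int N - 1. ?h k)"
    by (rule sum.reindex_bij_witness[of _ uminus uminus]) auto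
  finally have "(\<Sum>k = - int N + 1..int N - 1. ?h k) \<in> \<real>"
    by (simp add: Reals_cnj_iff)
  then show ?thesis
    unfolding f_tilde_def by (intro Reals_mult Reals_divide) auto
qed

end

theory Submission
  imports Defs "HOL-Real_Asymp.Real_Asymp"
begin

text \<open>
  Since \<open>G(\<nu>)\<close> is the expectation of \<open>exp (-2\<pi>\<i>Z\<nu>)\<close>, the density \<open>N/T f\<close> is the average over the
  finitely many values \<open>w\<close> of \<open>Z\<close> of Dirichlet kernels centred at \<open>w\<close>. The interval \<open>I\<close> is exactly one
  period and contains all those \<open>w\<close> in its interior, so integrating from its left end to \<open>x\<close> gives
  a difference of two partial sums of the sawtooth series, which tends to \<open>1\<close> if \<open>w < x\<close> and to \<open>0\<close>
  if \<open>w > x\<close>.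
\<close>

section \<open>Dirichlet kernel sums and the sawtooth series\<close>

text \<open>The sum telescopes, because \<open>2 * sin (t / 2) * cos (k * t)\<close> is the
  difference of \<open>sin ((k + 1 / 2) * t)\<close> and \<open>sin ((k - 1 / 2) * t)\<close>. The
  factor stays on the left, so zeros of \<open>sin (t / 2)\<close> need no exception.\<close>

lemma Dirichlet_kernel_cos:
  fixes t :: real
  assumes "N \<ge> 1"
  shows "2 * sin (t / 2) * (\<Sum>k = 1..<N. cos (real k * t)) = sin ((real N - 1 / 2) * t) - sin (t / 2)"
  using assms
proof (induction N rule: dec_induct)
  case base
  then show ?case by simp
next
  case (step N)
  have "sin ((real (Suc N) - 1 / 2) * t) = sin (real N * t + t / 2)"
       "sin ((real N - 1 / 2) * t) = sin (real N * t - t / 2)"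
    by (simp_all add: algebra_simps)
  then show ?case
    using step by (simp add: algebra_simps sin_add sin_diff)
qed

text \<open>The corrected error \<open>R N\<close> vanishes at \<open>pi\<close>, and its derivative
  is of order \<open>1/N\<close> uniformly between \<open>pi\<close> and \<open>\<theta>\<close>.
  The mean value bound therefore sends \<open>R N \<theta>\<close> to 0, and so does the correction
  term itself.\<close>

lemma tendsto_sawtooth:
  fixes \<theta> :: real
  assumes "0 < \<theta>" "\<theta> < 2 * pi"
  shows "(\<lambda>N. \<Sum>k = 1..<N. sin (real k * \<theta>) / real k) \<longlonglongrightarrow> (pi - \<theta>) / 2"
proof -
  \<comment> \<open>The segment between \<open>\<theta>\<close> and \<open>pi\<close>, in whichever
    order they lie. It is a compact part of the open interval from 0 to \<open>2 * pi\<close>, so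
    \<open>sin (t / 2)\<close> is bounded away from 0 on it.\<close>
  define S where "S = {min \<theta> pi..max \<theta> pi}"
  have sin_pos: "sin (t / 2) > 0" if "t \<in> S" for t
    using that assms by (intro sin_gt_zero) (auto simp: S_def min_def max_def split: if_splits)
  have "compact ((\<lambda>t. 1 / (4 * sin (t / 2) ^ 2)) ` S)"
    using sin_pos by (intro compact_continuous_image continuous_intros) (force simp: S_def)+
  then obtain C where C: "\<And>t. t \<in> S \<Longrightarrow> \<bar>1 / (4 * sin (t / 2) ^ 2)\<bar> \<le> C"
    by (metis (mono_tags, lifting) bounded_real compact_imp_bounded imageI)
  \<comment> \<open>Integrating the Dirichlet kernel from \<open>\<pi>\<close> to \<open>\<theta>\<close> by parts: the boundary term is added to the
    error so that the derivative of the sum is of order \<open>1/N\<close>.\<close>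
  define R where "R N t = (\<Sum>k = 1..<N. sin (real k * t) / real k) - (pi - t) / 2
      + cos ((real N - 1 / 2) * t) / ((real N - 1 / 2) * (2 * sin (t / 2)))" for N t
  define R' where "R' N t = - cos ((real N - 1 / 2) * t) * cos (t / 2) / ((real N - 1 / 2) * (4 * sin (t / 2) ^ 2))"
    for N t
  have deriv: "(R N has_field_derivative R' N t) (at t within S)" if "N \<ge> 1" "t \<in> S" for N t
  proof -
    define r where "r = real N - 1 / 2"
    have r: "r > 0" using that by (simp add: r_def)
    have s: "sin (t / 2) > 0" using sin_pos that by simp
    have "((\<lambda>t. \<Sum>k = 1..<N. sin (real k * t) / real k) has_field_derivative (\<Sum>k = 1..<N. cos (real k * t)))
            (at t within S)"
      by (rule DERIV_sum) (auto intro!: derivative_eq_intros)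
    also have "(\<Sum>k = 1..<N. cos (real k * t)) = sin (r * t) / (2 * sin (t / 2)) - 1 / 2"
      using Dirichlet_kernel_cos[OF that(1), of t] s by (simp add: r_def field_simps)
    finally have 1: "((\<lambda>t. \<Sum>k = 1..<N. sin (real k * t) / real k) has_field_derivative
        sin (r * t) / (2 * sin (t / 2)) - 1 / 2) (at t within S)" .
    \<comment> \<open>Differentiating the cosine cancels the sine quotient of \<open>1\<close>. What
      remains comes from differentiating \<open>1 / sin (t / 2)\<close> and keeps the small factor
      \<open>1 / r\<close>.\<close>
    have 2: "((\<lambda>t. cos (r * t) / (r * (2 * sin (t / 2)))) has_field_derivative
        - sin (r * t) / (2 * sin (t / 2)) + R' N t) (at t within S)"
      unfolding R'_def r_def[symmetric]
      using r s by (auto intro!: derivative_eq_intros simp: field_simps power2_eq_square)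
    have 3: "((\<lambda>t. (pi - t) / 2) has_field_derivative - 1 / 2) (at t within S)"
      by (auto intro!: derivative_eq_intros)
    show ?thesis
      unfolding R_def r_def[symmetric]
      by (rule DERIV_cong[OF DERIV_add[OF DERIV_diff[OF 1 3] 2]]) simp
  qed
  have bound: "\<bar>R' N t\<bar> \<le> C / (real N - 1 / 2)" if "N \<ge> 1" "t \<in> S" for N t
  proof -
    have r: "real N - 1 / 2 > 0" using that by simp
    have "\<bar>R' N t\<bar> = \<bar>cos ((real N - 1 / 2) * t)\<bar> * \<bar>cos (t / 2)\<bar> * (\<bar>1 / (4 * sin (t / 2) ^ 2)\<bar> / (real N - 1 / 2))"
      using r by (simp add: R'_def abs_mult)
    also have "\<dots> \<le> 1 * 1 * (C / (real N - 1 / 2))"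
      using r C[OF that(2)] by (intro mult_mono divide_right_mono) auto
    finally show ?thesis by simp
  qed
  \<comment> \<open>This is why \<open>pi\<close> is the base point: every
    \<open>sin (k * pi)\<close> is 0, the linear term is 0, and the half-integer frequency makes the
    cosine 0.\<close>
  have R_pi: "R N pi = 0" if "N \<ge> 1" for N
  proof -
    have "cos ((real N - 1 / 2) * pi) = cos (real N * pi - pi / 2)"
      by (simp add: algebra_simps)
    then have "cos ((real N - 1 / 2) * pi) = 0"
      by (simp add: cos_diff)
    then show ?thesis by (simp add: R_def)
  qed
  have R_bound: "\<bar>R N \<theta>\<bar> \<le> C / (real N - 1 / 2) * \<bar>\<theta> - pi\<bar>" if "N \<ge> 1" for N
    using field_differentiable_bound[of S "R N" "R' N" "C / (real N - 1 / 2)" \<theta> pi]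
      deriv bound that R_pi[OF that] by (auto simp: S_def)
  have "(\<lambda>N. C / (real N - 1 / 2) * \<bar>\<theta> - pi\<bar>) \<longlonglongrightarrow> 0"
    by real_asymp
  then have R0: "(\<lambda>N. R N \<theta>) \<longlonglongrightarrow> 0"
    by (rule Lim_null_comparison[rotated])
       (use R_bound in \<open>auto intro!: eventually_sequentiallyI[of 1]\<close>)
  have "(\<lambda>N. cos ((real N - 1 / 2) * \<theta>) / ((real N - 1 / 2) * (2 * sin (\<theta> / 2)))) \<longlonglongrightarrow> 0"
  proof (rule Lim_null_comparison)
    show "(\<lambda>N. 1 / ((real N - 1 / 2) * (2 * sin (\<theta> / 2)))) \<longlonglongrightarrow> 0"
      using sin_pos[of \<theta>] by (simp add: S_def) real_asymp
    show "\<forall>\<^sub>F N in sequentially. norm (cos ((real N - 1 / 2) * \<theta>) / ((real N - 1 / 2) * (2 * sin (\<theta> / 2))))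
        \<le> 1 / ((real N - 1 / 2) * (2 * sin (\<theta> / 2)))"
      using sin_pos[of \<theta>]
      by (intro eventually_sequentiallyI[of 1]) (auto simp: S_def abs_mult intro!: divide_right_mono)
  qed
  from tendsto_add[OF tendsto_diff[OF R0 this] tendsto_const[of "(pi - \<theta>) / 2"]]
  show ?thesis by (simp add: R_def)
qed


section \<open>The periodic Dirichlet kernel and its primitive\<close>

text \<open>The terms at \<open>k\<close> and \<open>- k\<close> are conjugate and add up to twice a
  cosine, and \<open>k = 0\<close> contributes 1. For \<open>N = 0\<close> the left range is empty
  while the right side is 1.\<close>

lemma sum_exp_symmetric:
  fixes t :: real
  assumes "N \<ge> 1"
  shows "(\<Sum>k = - int N + 1..int N - 1. exp (\<i> * of_real (of_int k * t)))
    = complex_of_real (1 + 2 * (\<Sum>k = 1..<N. cos (real k * t)))"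
  using assms
proof (induction N rule: dec_induct)
  case base
  then show ?case by simp
next
  case (step N)
  have "{- int (Suc N) + 1..int (Suc N) - 1} = insert (- int N) (insert (int N) {- int N + 1..int N - 1})"
    using step(1) by auto
  then have "(\<Sum>k = - int (Suc N) + 1..int (Suc N) - 1. exp (\<i> * complex_of_real (of_int k * t)))
      = exp (\<i> * complex_of_real (- real N * t)) + exp (\<i> * complex_of_real (real N * t))
        + (\<Sum>k = - int N + 1..int N - 1. exp (\<i> * complex_of_real (of_int k * t)))"
    using step(1) by (simp add: add.assoc)
  also have "exp (\<i> * complex_of_real (- real N * t)) + exp (\<i> * complex_of_real (real N * t))
      = complex_of_real (2 * cos (real N * t))"
    by (simp add: complex_eq_iff Re_exp Im_exp)
  finally show ?case
    unfolding step.IH using step(1) by simp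
qed

text \<open>The termwise primitive, vanishing at 0, of the \<open>T\<close>-periodic Dirichlet
  kernel divided by \<open>T\<close>.\<close>

definition Dirichlet_primitive :: "real \<Rightarrow> nat \<Rightarrow> real \<Rightarrow> real" where
  "Dirichlet_primitive T N d = d / T + (\<Sum>k = 1..<N. sin (real k * (2 * pi * d / T)) / real k) / pi"

lemma Dirichlet_primitive_minus: "Dirichlet_primitive T N (- d) = - Dirichlet_primitive T N d"
  by (simp add: Dirichlet_primitive_def sum_negf)

lemma has_real_derivative_Dirichlet_primitive:
  assumes "T > 0"
  shows "(Dirichlet_primitive T N has_real_derivative
    (1 + 2 * (\<Sum>k = 1..<N. cos (real k * (2 * pi * d / T)))) / T) (at d)"
proof -
  have "((\<lambda>d. \<Sum>k = 1..<N. sin (real k * (2 * pi * d / T)) / real k) has_real_derivative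
      (\<Sum>k = 1..<N. cos (real k * (2 * pi * d / T)) * (2 * pi / T))) (at d)"
    by (rule DERIV_sum) (use assms in \<open>auto intro!: derivative_eq_intros simp: field_simps\<close>)
  then show ?thesis
    unfolding Dirichlet_primitive_def using assms
    by (auto intro!: derivative_eq_intros simp: field_simps simp flip: sum_distrib_left sum_distrib_right sum_divide_distrib)
qed

text \<open>The sawtooth limit divided by \<open>pi\<close> is \<open>1 / 2 - d / T\<close>; its
  slope is compensated by the linear term \<open>d / T\<close>, which stems from the constant
  Fourier mode.\<close>

lemma Dirichlet_primitive_tendsto_pos:
  assumes "0 < d" "d < T"
  shows "(\<lambda>N. Dirichlet_primitive T N d) \<longlonglongrightarrow> 1 / 2"
proof -
  have "(\<lambda>N. Dirichlet_primitive T N d) \<longlonglongrightarrow> d / T + (pi - 2 * pi * d / T) / 2 / pi"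
    unfolding Dirichlet_primitive_def using assms
    by (intro tendsto_intros tendsto_sawtooth) (auto simp: field_simps)
  also have "d / T + (pi - 2 * pi * d / T) / 2 / pi = 1 / 2"
    using assms by (simp add: field_simps)
  finally show ?thesis .
qed

lemma Dirichlet_primitive_tendsto_neg:
  assumes "- T < d" "d < 0"
  shows "(\<lambda>N. Dirichlet_primitive T N d) \<longlonglongrightarrow> - 1 / 2"
  using tendsto_minus[OF Dirichlet_primitive_tendsto_pos[of "- d" T]] assms
  by (simp add: Dirichlet_primitive_minus)

section \<open>Finitely supported laws and the characteristic function of the sum\<close>

text \<open>Almost everywhere \<open>f\<close> equals a finite combination of indicators of points.
  Values in a Banach space let the result serve both complex exponentials and real
  indicators.\<close>

lemma (in real_distribution) integral_finite_support:
  fixes f :: "real \<Rightarrow> 'b::{banach, second_countable_topology}"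
  assumes "finite W" and W: "AE x in M. x \<in> W" and [measurable]: "f \<in> borel_measurable borel"
  shows "(LINT x|M. f x) = (\<Sum>w\<in>W. prob {w} *\<^sub>R f w)"
proof -
  have "(LINT x|M. f x) = (LINT x|M. (\<Sum>w\<in>W. indicator {w} x *\<^sub>R f w))"
  proof (rule integral_cong_AE)
    show "AE x in M. f x = (\<Sum>w\<in>W. indicator {w} x *\<^sub>R f w)"
      using W
    proof eventually_elim
      case (elim x)
      have "(\<Sum>w\<in>W. indicator {w} x *\<^sub>R f w) = (\<Sum>w\<in>W. if w = x then f x else 0)"
        by (intro sum.cong) auto
      also have "\<dots> = f x"
        using elim \<open>finite W\<close> by simp
      finally show ?case ..
    qed
  qed auto
  also have "\<dots> = (\<Sum>w\<in>W. prob {w} *\<^sub>R f w)"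
    by (subst Bochner_Integration.integral_sum) (auto simp: emeasure_eq_measure)
  finally show ?thesis .
qed

lemma (in real_distribution) cdf_finite_support:
  assumes "finite W" and "AE x in M. x \<in> W"
  shows "cdf M x = (\<Sum>w\<in>W. prob {w} * of_bool (w \<le> x))"
proof -
  have "cdf M x = (LINT y|M. indicator {..x} y)"
    by (simp add: cdf_def)
  also have "\<dots> = (\<Sum>w\<in>W. prob {w} *\<^sub>R indicator {..x} w)"
    using assms by (intro integral_finite_support) auto
  finally show ?thesis
    by (simp add: indicator_def)
qed

text \<open>A law on the line is determined by its distribution function. Drawing the index
  uniformly and then applying \<open>X\<close> gives repeated sample values their
  multiplicity.\<close>

lemma distr_of_cdf_emp_cdf:
  assumes "real_distribution \<mu>" and "n \<ge> 1" and "cdf \<mu> = emp_cdf n X"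
  shows "\<mu> = distr (measure_pmf (pmf_of_set {1..n})) borel X"
proof (rule cdf_unique)
  show "real_distribution (distr (measure_pmf (pmf_of_set {1..n})) borel X)"
    by (rule prob_space.real_distribution_distr[OF prob_space_measure_pmf]) simp
  have "cdf (distr (measure_pmf (pmf_of_set {1..n})) borel X) x = emp_cdf n X x" for x
  proof -
    have "card ({1..n} \<inter> X -` {..x}) = (\<Sum>l = 1..n. of_bool (X l \<le> x))"
      by (simp add: Int_def)
    then show ?thesis
      using assms(2) by (simp add: cdf_def measure_distr emp_cdf_def measure_pmf_of_set)
  qed
  then show "cdf \<mu> = cdf (distr (measure_pmf (pmf_of_set {1..n})) borel X)"
    using assms(3) by auto
qed (fact assms(1))


lemma char_distr_pmf_of_set:
  assumes "n \<ge> 1"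
  shows "char (distr (measure_pmf (pmf_of_set {1..n})) borel X) t
    = 1 / of_nat n * (\<Sum>l = 1..n. exp (\<i> * of_real (t * X l)))"
proof -
  have "char (distr (measure_pmf (pmf_of_set {1..n})) borel X) t
      = (LINT l|measure_pmf (pmf_of_set {1..n}). exp (\<i> * of_real (t * X l)))"
    by (simp add: char_def integral_distr)
  also have "\<dots> = (\<Sum>l = 1..n. exp (\<i> * of_real (t * X l))) / of_nat n"
    using assms by (subst integral_measure_pmf[of "{1..n}"]) (auto simp: sum_divide_distrib scaleR_conv_of_real)
  finally show ?thesis by simp
qed

context prob_space
begin

context
  fixes n m :: nat and X a :: "nat \<Rightarrow> real" and Y :: "nat \<Rightarrow> 'a \<Rightarrow> real"
  assumes n: "n \<ge> 1"
    and indep: "indep_vars (\<lambda>_. borel) Y {1..m}"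
    and cdf_Y: "\<And>j. j \<in> {1..m} \<Longrightarrow> cdf (distr M borel (Y j)) = emp_cdf n X"
begin

lemma random_variable_Y: "j \<in> {1..m} \<Longrightarrow> random_variable borel (Y j)"
  using indep by (auto simp: indep_vars_def)

lemma distr_Y: "j \<in> {1..m} \<Longrightarrow> distr M borel (Y j) = distr (measure_pmf (pmf_of_set {1..n})) borel X"
  using n cdf_Y random_variable_Y by (intro distr_of_cdf_emp_cdf) auto

text \<open>Characteristic functions of independent summands multiply, and each factor
  \<open>a j\<close> moves into the argument.\<close>

lemma G_eq_char: "G n m X a \<nu> = char (distr M borel (\<lambda>\<omega>. \<Sum>j = 1..m. a j * Y j \<omega>)) (- 2 * pi * \<nu>)"
proof -
  have "indep_vars (\<lambda>_. borel) (\<lambda>j \<omega>. a j * Y j \<omega>) {1..m}"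
    by (rule indep_vars_compose2[OF indep]) simp
  then have "char (distr M borel (\<lambda>\<omega>. \<Sum>j = 1..m. a j * Y j \<omega>)) (- 2 * pi * \<nu>)
      = (\<Prod>j = 1..m. char (distr M borel (\<lambda>\<omega>. a j * Y j \<omega>)) (- 2 * pi * \<nu>))"
    by (rule char_distr_sum)
  also have "\<dots> = G n m X a \<nu>"
    unfolding G_def
  proof (rule prod.cong[OF refl])
    fix j assume j: "j \<in> {1..m}"
    note [measurable] = random_variable_Y[OF j]
    have "char (distr M borel (\<lambda>\<omega>. a j * Y j \<omega>)) (- 2 * pi * \<nu>)
        = char (distr M borel (Y j)) (- 2 * pi * \<nu> * a j)"
      by (simp add: char_def integral_distr mult_ac)
    also have "\<dots> = 1 / of_nat n * (\<Sum>l = 1..n. exp (- 2 * of_real pi * \<i> * of_real (a j * X l * \<nu>)))"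
      unfolding distr_Y[OF j] char_distr_pmf_of_set[OF n] by (simp add: mult_ac)
    finally show "char (distr M borel (\<lambda>\<omega>. a j * Y j \<omega>)) (- 2 * pi * \<nu>)
        = 1 / of_nat n * (\<Sum>l = 1..n. exp (- 2 * of_real pi * \<i> * of_real (a j * X l * \<nu>)))" .
  qed
  finally show ?thesis ..
qed

lemma AE_Y: "j \<in> {1..m} \<Longrightarrow> AE \<omega> in M. Y j \<omega> \<in> X ` {1..n}"
proof -
  assume j: "j \<in> {1..m}"
  have [measurable]: "X ` {1..n} \<in> sets borel"
    by (intro borel_closed finite_imp_closed finite_imageI finite_atLeastAtMost)
  have "AE x in distr (measure_pmf (pmf_of_set {1..n})) borel X. x \<in> X ` {1..n}"
    using n by (subst AE_distr_iff) (auto simp: AE_measure_pmf_iff simp del: One_nat_def)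
  then show ?thesis
    unfolding distr_Y[OF j, symmetric] by (subst (asm) AE_distr_iff) (auto simp: random_variable_Y[OF j] simp del: One_nat_def)
qed

lemma finite_support_linear_combination:
  obtains W where "finite W" "AE z in distr M borel (\<lambda>\<omega>. \<Sum>j = 1..m. a j * Y j \<omega>). z \<in> W"
proof
  \<comment> \<open>All combinations of sample values. Extensional functions are used because only
    then are there finitely many choices of \<open>y\<close>; hence the \<open>restrict\<close>
    below.\<close>
  define W where "W = (\<lambda>y. \<Sum>j = 1..m. a j * y j) ` ({1..m} \<rightarrow>\<^sub>E X ` {1..n})"
  show fin: "finite W"
    unfolding W_def by (intro finite_imageI finite_PiE) auto
  have "AE \<omega> in M. \<forall>j\<in>{1..m}. Y j \<omega> \<in> X ` {1..n}"
    by (rule AE_finite_allI[OF finite_atLeastAtMost AE_Y])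
  then have "AE \<omega> in M. (\<Sum>j = 1..m. a j * Y j \<omega>) \<in> W"
  proof eventually_elim
    case (elim \<omega>)
    have "(\<Sum>j = 1..m. a j * Y j \<omega>) = (\<Sum>j = 1..m. a j * restrict (\<lambda>j. Y j \<omega>) {1..m} j)"
      by simp
    moreover have "restrict (\<lambda>j. Y j \<omega>) {1..m} \<in> {1..m} \<rightarrow>\<^sub>E X ` {1..n}"
      using elim by auto
    ultimately show ?case
      unfolding W_def by (rule image_eqI)
  qed
  moreover have "W \<in> sets borel"
    using fin by (intro borel_closed finite_imp_closed)
  ultimately show "AE z in distr M borel (\<lambda>\<omega>. \<Sum>j = 1..m. a j * Y j \<omega>). z \<in> W"
    by (subst AE_distr_iff) (auto intro!: borel_measurable_sum borel_measurable_times random_variable_Y)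
qed

end

end

section \<open>The density as a mixture of Dirichlet kernels\<close>

text \<open>Exchanging the sums over \<open>k\<close> and \<open>w\<close> leaves one Dirichlet
  kernel centred at each atom \<open>w\<close>; the factor \<open>N\<close> cancels the
  \<open>1/N\<close> in \<open>f_tilde\<close>.\<close>

lemma scaled_f_tilde_eq:
  assumes "N \<ge> 1"
    and G: "\<And>\<nu>. G n m X a \<nu> = (\<Sum>w\<in>W. of_real (p w) * exp (- 2 * of_real pi * \<i> * of_real (w * \<nu>)))"
  shows "of_real (real N / T) * f_tilde n m X a T N x
    = complex_of_real (\<Sum>w\<in>W. p w * ((1 + 2 * (\<Sum>k = 1..<N. cos (real k * (2 * pi * (x - w) / T)))) / T))"
proof -
  have "g_coeff n m X a T k * exp (2 * of_real pi * \<i> * of_real (x * of_int k / T))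
      = (\<Sum>w\<in>W. of_real (p w) * exp (\<i> * of_real (of_int k * (2 * pi * (x - w) / T))))" for k
  proof -
    have "exp (- 2 * of_real pi * \<i> * of_real (w * (of_int k * (1 / T)))) * exp (2 * of_real pi * \<i> * of_real (x * of_int k / T))
        = exp (\<i> * complex_of_real (of_int k * (2 * pi * (x - w) / T)))" for w
      by (simp add: exp_add[symmetric] algebra_simps diff_divide_distrib)
    then show ?thesis
      by (simp only: g_coeff_def G sum_distrib_right mult.assoc)
  qed
  then have "f_tilde n m X a T N x = 1 / of_nat N *
      (\<Sum>w\<in>W. of_real (p w) * (\<Sum>k = - int N + 1..int N - 1. exp (\<i> * of_real (of_int k * (2 * pi * (x - w) / T)))))"
    unfolding f_tilde_def by (simp only: sum_distrib_left) (subst sum.swap, rule refl)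
  then show ?thesis
    using \<open>N \<ge> 1\<close> unfolding sum_exp_symmetric[OF \<open>N \<ge> 1\<close>]
    by (simp add: sum_distrib_left sum_divide_distrib)
qed

text \<open>Intersecting the half-line up to \<open>x\<close> with the interval leaves the segment
  from \<open>A\<close> to \<open>min x B\<close>, where the fundamental theorem of calculus applies
  to the mixture of primitives.\<close>

lemma F_tilde_eq:
  assumes "N \<ge> 1" "T > 0"
    and G: "\<And>\<nu>. G n m X a \<nu> = (\<Sum>w\<in>W. of_real (p w) * exp (- 2 * of_real pi * \<i> * of_real (w * \<nu>)))"
    and "A \<le> min x B"
  shows "F_tilde n m X a T {A..B} N x = complex_of_real
    (\<Sum>w\<in>W. p w * (Dirichlet_primitive T N (min x B - w) - Dirichlet_primitive T N (A - w)))"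
proof -
  define h where "h \<xi> = (\<Sum>w\<in>W. p w * ((1 + 2 * (\<Sum>k = 1..<N. cos (real k * (2 * pi * (\<xi> - w) / T)))) / T))" for \<xi>
  define H where "H \<xi> = (\<Sum>w\<in>W. p w * Dirichlet_primitive T N (\<xi> - w))" for \<xi>
  have "F_tilde n m X a T {A..B} N x = (LINT \<xi>:{..x}|lborel. complex_of_real (h \<xi> * indicator {A..B} \<xi>))"
    unfolding F_tilde_def scaled_f_tilde_eq[OF assms(1) G] h_def[symmetric]
    by (intro arg_cong[where f = "set_lebesgue_integral lborel {..x}"] ext) (simp split: split_indicator)
  also have "\<dots> = of_real (LINT \<xi>:{..x}|lborel. h \<xi> * indicator {A..B} \<xi>)"
    by (rule set_integral_complex_of_real)
  also have "(LINT \<xi>:{..x}|lborel. h \<xi> * indicator {A..B} \<xi>) = (\<integral>\<xi>. h \<xi> * indicator {A..min x B} \<xi> \<partial>lborel)"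
    unfolding set_lebesgue_integral_def
    by (intro Bochner_Integration.integral_cong) (auto simp: indicator_def)
  also have "\<dots> = H (min x B) - H A"
  proof (rule integral_FTC_Icc_real[OF assms(4)])
    fix \<xi>
    show "(H has_real_derivative h \<xi>) (at \<xi>)"
      unfolding H_def h_def
      by (intro DERIV_sum DERIV_cmult DERIV_shift[THEN iffD1, of _ _ _ "- _", simplified]
            has_real_derivative_Dirichlet_primitive[OF assms(2)])
    show "isCont h \<xi>"
      unfolding h_def using assms(2) by (intro continuous_intros) auto
  qed
  finally show ?thesis
    by (simp add: H_def sum_subtractf right_diff_distrib)
qed


section \<open>Convergence at the points of continuity\<close>

theorem theorem2:
  fixes n m :: nat and X a :: "nat \<Rightarrow> real" and T \<kappa> :: real
    and M :: "'a measure" and Y :: "nat \<Rightarrow> 'a \<Rightarrow> real" and Z :: "'a \<Rightarrow> real"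
    and F\<^sub>Z :: "real \<Rightarrow> real" and I A\<^sub>d :: "real set"
  assumes "n \<ge> 1" and "m \<ge> 1"
    and "prob_space M"
    and "prob_space.indep_vars M (\<lambda>_. borel) Y {1..m}"
    and "\<And>j. j \<in> {1..m} \<Longrightarrow> cdf (distr M borel (Y j)) = emp_cdf n X"
    and "Z = (\<lambda>\<omega>. \<Sum>j = 1..m. a j * Y j \<omega>)"
    and "F\<^sub>Z = cdf (distr M borel Z)"
    and "z_min M Z < 0" and "0 < z_max M Z"
    and "T > z_range M Z"
    and "\<kappa> = T / z_range M Z"
    and "I = {\<kappa> * z_min M Z..\<kappa> * z_max M Z}"
    and "A\<^sub>d = {x. \<not> isCont F\<^sub>Z x}"
  shows "\<forall>x \<in> UNIV - A\<^sub>d.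
    (\<lambda>N. F_tilde n m X a T I N x) \<longlonglongrightarrow> complex_of_real (F\<^sub>Z x)"
proof
  fix x assume x: "x \<in> UNIV - A\<^sub>d"
  interpret prob_space M by fact
  define \<mu> where "\<mu> = distr M borel Z"
  have [measurable]: "random_variable borel Z"
    using random_variable_Y[OF assms(1,4,5)] by (auto simp: assms(6))
  interpret \<mu>: real_distribution \<mu>
    unfolding \<mu>_def by (rule real_distribution_distr) simp
  obtain W where W: "finite W" "AE z in \<mu>. z \<in> W"
    using finite_support_linear_combination[OF assms(1,4,5), of a] unfolding \<mu>_def assms(6) by blast
  define p where "p w = measure \<mu> {w}" for w
  have pos_prob: "pos_prob_values M Z = {w. p w > 0}"
    by (simp add: pos_prob_values_def p_def \<mu>_def measure_distr vimage_def Int_def conj_commute)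
  have "p w = 0" if "w \<notin> W" for w
  proof -
    have "AE z in \<mu>. z \<notin> {w}"
      using W(2) by eventually_elim (use that in auto)
    then show ?thesis
      by (simp add: p_def \<mu>.prob_eq_0)
  qed
  \<comment> \<open>Finiteness makes \<open>Min\<close> and \<open>Max\<close> in
    \<open>z_min\<close> and \<open>z_max\<close> genuine bounds. \<open>W\<close> itself may
    contain points of probability 0, so the bounds are stated only where
    \<open>p w > 0\<close>.\<close>
  then have "finite {w. p w > 0}"
    by (intro finite_subset[OF _ W(1)]) force
  then have z_bounds: "z_min M Z \<le> w" "w \<le> z_max M Z" if "p w > 0" for w
    using that by (simp_all add: z_min_def z_max_def pos_prob)
  have G: "G n m X a \<nu> = (\<Sum>w\<in>W. of_real (p w) * exp (- 2 * of_real pi * \<i> * of_real (w * \<nu>)))" for \<nu>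
  proof -
    have "G n m X a \<nu> = (CLINT z|\<mu>. exp (\<i> * complex_of_real (- 2 * pi * \<nu> * z)))"
      using G_eq_char[OF assms(1,4,5), of a \<nu>] by (simp only: \<mu>_def assms(6) char_def)
    also have "\<dots> = (\<Sum>w\<in>W. p w *\<^sub>R exp (\<i> * complex_of_real (- 2 * pi * \<nu> * w)))"
      unfolding p_def by (rule \<mu>.integral_finite_support[OF W]) measurable
    finally show ?thesis
      by (simp add: scaleR_conv_of_real mult_ac)
  qed
  have F\<^sub>Z: "F\<^sub>Z y = (\<Sum>w\<in>W. p w * of_bool (w \<le> y))" for y
    unfolding assms(7) \<mu>_def[symmetric] p_def by (rule \<mu>.cdf_finite_support[OF W])
  \<comment> \<open>Continuity of \<open>F\<^sub>Z\<close> at \<open>x\<close> means that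
    \<open>x\<close> carries no mass. This rules out \<open>w = x\<close>, where the primitive is 0
    instead of tending to plus or minus one half.\<close>
  have px: "p x = 0"
    using x \<mu>.finite_borel_measure_M
    by (simp add: assms(7,13) \<mu>_def[symmetric] p_def finite_borel_measure.isCont_cdf)
  define A B where "A = \<kappa> * z_min M Z" and "B = \<kappa> * z_max M Z"
  have range_pos: "z_range M Z > 0"
    using assms(8,9) by (simp add: z_range_def)
  then have "\<kappa> > 1" and "T > 0"
    using assms(10) by (simp_all add: assms(11))
  \<comment> \<open>The signs of the extreme values matter here: scaling by
    \<open>\<kappa> > 1\<close> pushes a negative left end further left and a positive right end
    further right.\<close>
  have A: "A < z_min M Z" and B: "z_max M Z < B"
    using \<open>\<kappa> > 1\<close> assms(8,9) by (simp_all add: A_def B_def)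
  have "B - A = \<kappa> * z_range M Z"
    by (simp add: A_def B_def z_range_def right_diff_distrib)
  \<comment> \<open>The interval is exactly one period long, so a point of it and an atom strictly
    inside it differ by less than \<open>T\<close>, as the limits of the primitive require.\<close>
  then have BA: "B - A = T"
    using range_pos by (simp add: assms(11))
  show "(\<lambda>N. F_tilde n m X a T I N x) \<longlonglongrightarrow> complex_of_real (F\<^sub>Z x)"
  proof (cases "A \<le> x")
    \<comment> \<open>Left of \<open>A\<close> the integrand vanishes, and all atoms lie to the
      right of \<open>x\<close>, so both sides are 0.\<close>
    case False
    then have "F_tilde n m X a T I N x = 0" for N
      unfolding F_tilde_def set_lebesgue_integral_def assms(12) A_def[symmetric]
      by (subst Bochner_Integration.integral_cong[where g = "\<lambda>_. 0", OF refl]) (auto simp: indicator_def)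
    moreover have "p w * of_bool (w \<le> x) = 0" for w
      using False A z_bounds(1)[of w] measure_nonneg[of \<mu> "{w}"] by (auto simp: p_def order_less_le)
    ultimately show ?thesis
      by (simp only: F\<^sub>Z sum.neutral_const of_real_0 tendsto_const)
  next
    case True
    define x' where "x' = min x B"
    have "A \<le> x'"
      using True A B assms(8,9) by (simp add: x'_def)
    have lim: "(\<lambda>N. p w * (Dirichlet_primitive T N (x' - w) - Dirichlet_primitive T N (A - w)))
        \<longlonglongrightarrow> p w * of_bool (w \<le> x)" for w
    proof (cases "p w > 0")
      case False
      then have "p w = 0"
        using measure_nonneg[of \<mu> "{w}"] by (simp add: p_def)
      then show ?thesis by simp
    next
      case True
      then have w: "A < w" "w < B" "w \<noteq> x"
        using z_bounds[OF True] A B px by auto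
      have lim_A: "(\<lambda>N. Dirichlet_primitive T N (A - w)) \<longlonglongrightarrow> - 1 / 2"
        using w BA by (intro Dirichlet_primitive_tendsto_neg) auto
      show ?thesis
      proof (cases "w < x")
        case True
        then have "(\<lambda>N. Dirichlet_primitive T N (x' - w)) \<longlonglongrightarrow> 1 / 2"
          using w BA by (intro Dirichlet_primitive_tendsto_pos) (auto simp: x'_def)
        from tendsto_mult_left[OF tendsto_diff[OF this lim_A], of "p w"] show ?thesis
          using True by simp
      \<comment> \<open>For \<open>w > x\<close> both primitives tend to minus one half and their
        difference vanishes in the limit; for \<open>w < x\<close> the limits differ by 1.\<close>
      next
        case False
        then have "(\<lambda>N. Dirichlet_primitive T N (x' - w)) \<longlonglongrightarrow> - 1 / 2"
          using w BA \<open>A \<le> x'\<close> by (intro Dirichlet_primitive_tendsto_neg) (auto simp: x'_def)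
        from tendsto_mult_left[OF tendsto_diff[OF this lim_A], of "p w"] show ?thesis
          using False w by simp
      qed
    qed
    have "(\<lambda>N. complex_of_real (\<Sum>w\<in>W. p w * (Dirichlet_primitive T N (x' - w) - Dirichlet_primitive T N (A - w))))
        \<longlonglongrightarrow> complex_of_real (F\<^sub>Z x)"
      unfolding F\<^sub>Z by (intro tendsto_of_real tendsto_sum lim)
    then show ?thesis
      \<comment> \<open>The closed form of \<open>F_tilde\<close> is available only for
        \<open>N \<ge> 1\<close>, so the sequences are matched eventually.\<close>
      by (rule Lim_transform_eventually)
         (use F_tilde_eq[OF _ \<open>T > 0\<close> G \<open>A \<le> x'\<close>[unfolded x'_def]] in
           \<open>auto intro!: eventually_sequentiallyI[of 1] simp: assms(12) A_def B_def x'_def\<close>)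
  qed
qed

end
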